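(* Let $H:\mathbb{R}\to[0,1]$ be a seed function and define $g:\mathbb{R}\to[0,\infty)$ by $g(y)=H(y)-H(y-1)$ for every $y\in\mathbb{R}$. Then the generator $(g_k)_{k\in\mathbb{Z}}$ associated with $g$, i.e. $g_k(u)=g(k+u)$ for $k\in\mathbb{Z}$ and $u\in[0,1)$, is uniform.
   Context: A seed function is a function $H:\mathbb{R}\to[0,1]$ such that: (1) $H(y-1)\le H(y)$ for all $y\in\mathbb{R}$ ("unit interval increasing"); (2) $H(y)\to 0$ as $y\to-\infty$; (3) $H(y)\to 1$ as $y\to+\infty$. A generator is a family of functions $(g_k)_{k\in\mathbb{Z}}$, each mapping $[0,1)$ into $[0,\infty)$. A generator is uniform if $\sum_{k\in\mathbb{Z}} g_k(u)=1$ for all $u\in[0,1)$, where the convergence of this series of functions of $u$ is uniform on $[0,1)$. *)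

theory Defs
  imports "HOL-Analysis.Analysis"
begin

definition unit_interval_increasing :: "(real \<Rightarrow> real) \<Rightarrow> bool" where
  "unit_interval_increasing H \<longleftrightarrow> (\<forall>y. H (y - 1) \<le> H y)"

definition seed_function :: "(real \<Rightarrow> real) \<Rightarrow> bool" where
  "seed_function H \<longleftrightarrow>
     range H \<subseteq> {0..1} \<and> unit_interval_increasing H \<and>
     (H \<longlongrightarrow> 0) at_bot \<and> (H \<longlongrightarrow> 1) at_top"

text \<open>Functions on [0,1) are total functions on the reals whose values outside
  [0,1) are irrelevant.\<close>

definition generator :: "(int \<Rightarrow> real \<Rightarrow> real) \<Rightarrow> bool" where
  "generator g \<longleftrightarrow> (\<forall>k. g k ` {0..<1} \<subseteq> {0..})"

text \<open>Convergence is that of the finite partial sums along the net of finite subsets of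
  the integers, i.e. the filter underlying \<open>has_sum\<close>, but uniform in u. As the terms
  are nonnegative, this agrees with uniform convergence of the two-sided partial sums
  from -M to N.\<close>

definition uniform_generator :: "(int \<Rightarrow> real \<Rightarrow> real) \<Rightarrow> bool" where
  "uniform_generator g \<longleftrightarrow>
     generator g \<and>
     uniform_limit {0..<1} (\<lambda>F u. \<Sum>k\<in>F. g k u) (\<lambda>u. 1) (finite_subsets_at_top UNIV)"

definition associated_generator :: "(real \<Rightarrow> real) \<Rightarrow> int \<Rightarrow> real \<Rightarrow> real" where
  "associated_generator g k u = g (of_int k + u)"

end

theory Submission
  imports Defs
begin

text \<open>
  The series telescopes: the sum of \<open>g (k + u)\<close> over the symmetric block \<open>-n \<le> k \<le> n\<close> is
  \<open>H (n + u) - H (-n - 1 + u)\<close>.  Since \<open>0 \<le> H \<le> 1\<close>, every such block sums to at most \<open>1\<close>.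
  As \<open>u\<close> ranges over \<open>[0,1)\<close>, the two arguments are at least \<open>n\<close> and less than \<open>-n\<close>, so the limits
  of \<open>H\<close> at the two infinities make the block sums close to \<open>1\<close> with an \<open>n\<close> that does not
  depend on \<open>u\<close>.  The terms are nonnegative because \<open>H\<close> is unit interval increasing; hence
  the sum over a finite set of indices containing the block is at least the block sum, and,
  being dominated by the sum over some larger block, it is still at most \<open>1\<close>
  (\<open>sum_unit_differences_le_1\<close>).
\<close>

lemma sum_unit_differences_symmetric:
  fixes H :: "real \<Rightarrow> 'a::ab_group_add"
  shows "(\<Sum>k\<in>{-int n..int n}. H (of_int k + u) - H (of_int k + u - 1))
           = H (real n + u) - H (- real n - 1 + u)"
proof (induction n)
  case 0
  show ?case by (simp add: add.commute)
next
  case (Suc n)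
  have "{-int (Suc n)..int (Suc n)}
          = insert (int (Suc n)) (insert (-int (Suc n)) {-int n..int n})"
    by auto
  then have "(\<Sum>k\<in>{-int (Suc n)..int (Suc n)}. H (of_int k + u) - H (of_int k + u - 1))
          = (H (real n + 1 + u) - H (real n + u)) + (H (- real n - 1 + u) - H (- real n - 2 + u))
            + (\<Sum>k\<in>{-int n..int n}. H (of_int k + u) - H (of_int k + u - 1))"
    by (simp add: algebra_simps)
  also have "\<dots> = H (real n + 1 + u) - H (- real n - 2 + u)"
    by (simp only: Suc.IH) simp
  finally show ?case
    by (simp add: algebra_simps)
qed

lemma finite_int_set_subset_symmetric:
  assumes "finite (F :: int set)"
  obtains n where "F \<subseteq> {-int n..int n}"
proof -
  obtain n where n: "\<And>k. k \<in> F \<Longrightarrow> nat \<bar>k\<bar> \<le> n"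
    using finite_nat_set_iff_bounded_le[of "(\<lambda>k. nat \<bar>k\<bar>) ` F"] assms by auto
  have "F \<subseteq> {-int n..int n}"
    using n by fastforce
  then show thesis by (rule that)
qed

lemma seed_function_nonneg: "seed_function H \<Longrightarrow> 0 \<le> H y"
  and seed_function_le_1: "seed_function H \<Longrightarrow> H y \<le> 1"
  and seed_function_diff_nonneg: "seed_function H \<Longrightarrow> 0 \<le> H y - H (y - 1)"
  by (auto simp: seed_function_def unit_interval_increasing_def image_subset_iff)

text \<open>The finite index set may have gaps, so its sum need not telescope; filling the gaps
  up to a symmetric block only adds nonnegative terms.\<close>

lemma sum_unit_differences_le_1:
  assumes H: "seed_function H" and "finite F"
  shows "(\<Sum>k\<in>F. H (of_int k + u) - H (of_int k + u - 1)) \<le> 1"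
proof -
  obtain n where "F \<subseteq> {-int n..int n}"
    using finite_int_set_subset_symmetric[OF \<open>finite F\<close>] .
  then have "(\<Sum>k\<in>F. H (of_int k + u) - H (of_int k + u - 1))
               \<le> (\<Sum>k\<in>{-int n..int n}. H (of_int k + u) - H (of_int k + u - 1))"
    by (intro sum_mono2 seed_function_diff_nonneg[OF H]) auto
  also have "\<dots> = H (real n + u) - H (- real n - 1 + u)"
    by (rule sum_unit_differences_symmetric)
  also have "\<dots> \<le> 1"
    using seed_function_le_1[OF H, of "real n + u"]
      seed_function_nonneg[OF H, of "- real n - 1 + u"] by linarith
  finally show ?thesis .
qed

theorem proposition4p1:
  fixes H g :: "real \<Rightarrow> real"
  assumes "seed_function H"
    and "\<And>y. g y = H y - H (y - 1)"
  shows "uniform_generator (associated_generator g)"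
proof -
  note H = assms(1)
  have G: "associated_generator g k u = H (of_int k + u) - H (of_int k + u - 1)" for k u
    by (simp add: associated_generator_def assms(2))
  have "generator (associated_generator g)"
    using seed_function_diff_nonneg[OF H] by (auto simp: generator_def G)
  moreover have "uniform_limit {0..<1} (\<lambda>F u. \<Sum>k\<in>F. associated_generator g k u) (\<lambda>u. 1)
                   (finite_subsets_at_top UNIV)"
  proof (rule uniform_limitI)
    fix e :: real
    assume "e > 0"
    have "\<forall>\<^sub>F y in at_bot. H y < e/2"
      using H \<open>e > 0\<close> by (intro order_tendstoD) (auto simp: seed_function_def)
    then obtain a where a: "\<And>y. y \<le> a \<Longrightarrow> H y < e/2"
      by (auto simp: eventually_at_bot_linorder)
    have "\<forall>\<^sub>F y in at_top. 1 - e/2 < H y"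
      using H \<open>e > 0\<close> by (intro order_tendstoD) (auto simp: seed_function_def)
    then obtain b where b: "\<And>y. b \<le> y \<Longrightarrow> 1 - e/2 < H y"
      by (auto simp: eventually_at_top_linorder)
    obtain n where n: "max b (-a) \<le> real n"
      using real_arch_simple by blast
    have close: "dist (\<Sum>k\<in>F. associated_generator g k u) 1 < e"
      if F: "finite F" "{-int n..int n} \<subseteq> F" and u: "u \<in> {0..<1}" for F u
    proof -
      have "1 - e < H (real n + u) - H (- real n - 1 + u)"
        using a[of "- real n - 1 + u"] b[of "real n + u"] n u by auto
      also have "\<dots> = (\<Sum>k\<in>{-int n..int n}. H (of_int k + u) - H (of_int k + u - 1))"
        by (rule sum_unit_differences_symmetric[symmetric])
      also have "\<dots> \<le> (\<Sum>k\<in>F. H (of_int k + u) - H (of_int k + u - 1))"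
        using F by (intro sum_mono2 seed_function_diff_nonneg[OF H])
      finally show ?thesis
        using sum_unit_differences_le_1[OF H \<open>finite F\<close>, of u] \<open>e > 0\<close>
        by (simp only: G dist_real_def)
    qed
    then show "\<forall>\<^sub>F F in finite_subsets_at_top UNIV.
                 \<forall>u\<in>{0..<1}. dist (\<Sum>k\<in>F. associated_generator g k u) 1 < e"
      unfolding eventually_finite_subsets_at_top
      by (intro exI[of _ "{-int n..int n}"]) auto
  qed
  ultimately show ?thesis
    by (simp add: uniform_generator_def)
qed

end
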